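(* For any $X\in\mathbb{R}^{M\times N}$ the projections $\mathbf{P}_{k,s}=\mathbf{T}_k\circ\mathbf{H}_s$ and $\hat{\mathbf{P}}_{k,s}=\mathbf{H}_s\circ\mathbf{T}_k$ map into $\mathcal{M}_{k,s}$ and are quasi-optimal in the sense that $$\|X-\mathbf{P}_{k,s}(X)\|_F\le\sqrt{2}\,\|X-\mathbf{P}_{\mathcal{M}_{k,s}}(X)\|_F,\qquad \|X-\hat{\mathbf{P}}_{k,s}(X)\|_F\le\sqrt{2}\,\|X-\mathbf{P}_{\mathcal{M}_{k,s}}(X)\|_F.$$
   Context: $M,N,k,s$ are positive integers with $k<s\le M$. $\|X\|_0$ denotes the number of nonzero rows of $X\in\mathbb{R}^{M\times N}$, and $\mathcal{M}_{k,s}=\{X\in\mathbb{R}^{M\times N}:\operatorname{rank}(X)\le k,\ \|X\|_0\le s\}$. A metric projection $\mathbf{P}_{\mathcal{M}_{k,s}}(X)$ is an element of $\mathcal{M}_{k,s}$ with $\|X-\mathbf{P}_{\mathcal{M}_{k,s}}(X)\|_F\le\|X-Y\|_F$ for all $Y\in\mathcal{M}_{k,s}$. $\mathbf{H}_s(X)=X_S$, where $S\subseteq\{1,\dots,M\}$ contains the indices of $s$ rows of $X$ with largest Euclidean norm, and $X_S$ denotes $X$ with all rows not in $S$ set to zero. $\mathbf{T}_k(X)$ is a best approximation of $X$ in Frobenius norm by matrices of rank at most $k$, obtained by truncating a singular value decomposition of $X$ to its $k$ dominant singular values and vectors. Both maps may be set-valued, in which case some specific (arbitrary) selection rule is applied.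 *)

theory Defs
  imports "HOL-Analysis.Analysis"
begin

text \<open>
  A real \<open>M \<times> N\<close> matrix is an element of \<open>real ^ 'n ^ 'm\<close> with \<open>M = CARD('m)\<close> and
  \<open>N = CARD('n)\<close>. The library norm of this type is the Frobenius norm:
\<close>

lemma norm_eq_frobenius:
  fixes X :: "real ^ 'n ^ 'm"
  shows "norm X = sqrt (\<Sum>i\<in>UNIV. \<Sum>j\<in>UNIV. (X $ i $ j)\<^sup>2)"
  by (simp add: norm_vec_def L2_set_def sum_nonneg)

definition num_nonzero_rows :: "real ^ 'n ^ 'm \<Rightarrow> nat" where
  "num_nonzero_rows X = card {i. row i X \<noteq> 0}"

definition low_rank_row_sparse :: "nat \<Rightarrow> nat \<Rightarrow> (real ^ 'n ^ 'm) set" where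
  "low_rank_row_sparse k s = {X. rank X \<le> k \<and> num_nonzero_rows X \<le> s}"

definition metric_projections ::
    "(real ^ 'n ^ 'm) set \<Rightarrow> real ^ 'n ^ 'm \<Rightarrow> (real ^ 'n ^ 'm) set" where
  "metric_projections A X = {Z \<in> A. \<forall>Y\<in>A. norm (X - Z) \<le> norm (X - Y)}"

definition restrict_rows :: "'m set \<Rightarrow> real ^ 'n ^ 'm \<Rightarrow> real ^ 'n ^ 'm" where
  "restrict_rows S X = (\<chi> i. if i \<in> S then row i X else 0)"

text \<open>All possible values of \<open>H\<^sub>s(X)\<close>; there are several when row norms tie.\<close>

definition hard_thresholdings :: "nat \<Rightarrow> real ^ 'n ^ 'm \<Rightarrow> (real ^ 'n ^ 'm) set" where
  "hard_thresholdings s X =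
     {restrict_rows S X | S.
        card S = s \<and> (\<forall>i\<in>S. \<forall>j\<in>-S. norm (row j X) \<le> norm (row i X))}"

definition outer_prod :: "real ^ 'm \<Rightarrow> real ^ 'n \<Rightarrow> real ^ 'n ^ 'm" where
  "outer_prod u v = (\<chi> i j. u $ i * v $ j)"

definition orthonormal_upto :: "nat \<Rightarrow> (nat \<Rightarrow> 'a::real_inner) \<Rightarrow> bool" where
  "orthonormal_upto p u \<longleftrightarrow> (\<forall>i<p. \<forall>j<p. u i \<bullet> u j = (if i = j then 1 else 0))"

text \<open>
  The thin singular value decomposition \<open>X = \<Sum>i<p. \<sigma>\<^sub>i u\<^sub>i v\<^sub>i\<^sup>T\<close> with \<open>p = min M N\<close>; singular
  values (zeros included) are listed in decreasing order and indexed from 0.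
  Values of \<open>\<sigma>\<close>, \<open>u\<close>, \<open>v\<close> at indices \<open>\<ge> p\<close> are irrelevant.
\<close>

definition is_svd ::
    "real ^ 'n ^ 'm \<Rightarrow> (nat \<Rightarrow> real) \<Rightarrow> (nat \<Rightarrow> real ^ 'm) \<Rightarrow> (nat \<Rightarrow> real ^ 'n) \<Rightarrow> bool" where
  "is_svd X \<sigma> u v \<longleftrightarrow>
     (let p = min CARD('m) CARD('n) in
        (\<forall>i<p. 0 \<le> \<sigma> i) \<and>
        (\<forall>i j. i \<le> j \<and> j < p \<longrightarrow> \<sigma> j \<le> \<sigma> i) \<and>
        orthonormal_upto p u \<and> orthonormal_upto p v \<and>
        X = (\<Sum>i<p. \<sigma> i *\<^sub>R outer_prod (u i) (v i)))"

text \<open>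
  All possible values of \<open>T\<^sub>k(X)\<close>; different decompositions of \<open>X\<close> may give different
  truncations. For \<open>k \<ge> min M N\<close> nothing is cut off.
\<close>

definition svd_truncations :: "nat \<Rightarrow> real ^ 'n ^ 'm \<Rightarrow> (real ^ 'n ^ 'm) set" where
  "svd_truncations k X =
     {\<Sum>i<min k (min CARD('m) CARD('n)). \<sigma> i *\<^sub>R outer_prod (u i) (v i) | \<sigma> u v. is_svd X \<sigma> u v}"

end

theory Submission
  imports Defs
begin

text \<open>
  Both bounds come from a Pythagorean splitting of the error. Truncating a singular value
  decomposition replaces every row \<open>x\<close> by \<open>\<pi> x\<close>, where \<open>\<pi>\<close> is the orthogonal projection
  onto the span of the dominant right singular vectors
  (\<open>svd_truncation_row_projection\<close>). Consequently truncation keeps zero rows zero and its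
  residual is orthogonal, row by row, to the range of \<open>\<pi>\<close>. Write \<open>Y\<close> for a best
  approximation of \<open>X\<close> in the target set.

  For \<open>T \<circ> H\<close>, the residual \<open>X - H X\<close> lives on the discarded rows and \<open>H X - T (H X)\<close> on
  the retained rows \<open>S\<close>, so the squared errors add up. The first is at most
  \<open>(norm (X - Y))\<^sup>2\<close> because \<open>H\<close> is a best row-sparse approximation; the second is at most
  the squared distance of \<open>H X\<close> to \<open>Y\<close> restricted to \<open>S\<close>, because \<open>T\<close> is a best low-rank
  approximation and restricting rows does not raise the rank.

  For \<open>H \<circ> T\<close>, the residual \<open>X - T X\<close> is orthogonal to \<open>T X - H (T X)\<close>, whose rows lie in
  the range of \<open>\<pi>\<close>. The first is controlled by low-rank optimality. For the second, compare
  \<open>H (T X)\<close> with the row-sparse matrix obtained by applying \<open>\<pi>\<close> to the rows of \<open>Y\<close>, using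
  that \<open>\<pi>\<close> is a contraction.

  The two optimality facts (\<open>hard_thresholding_optimal\<close> and the Eckart--Young theorem
  \<open>svd_truncation_optimal\<close>) rest on the same rearrangement inequality
  \<open>sum_weighted_le_sum_largest\<close>: weights in \<open>[0,1]\<close> of total mass at most \<open>card S\<close> are
  best spent on the \<open>card S\<close> largest of the given nonnegative values.
\<close>

section \<open>Orthonormal families\<close>

text \<open>
  Completing the square in the coefficients. The case \<open>x = 0\<close> is Parseval's identity, the
  choice \<open>c i = x \<bullet> e i\<close> yields Bessel's inequality, and general \<open>c\<close> bounds the distance of
  \<open>x\<close> to the span from below.
\<close>

lemma norm_diff_orthonormal_combination:
  fixes e :: "'i \<Rightarrow> 'a::real_inner"
  assumes fin: "finite I"
    and orth: "\<And>i j. i \<in> I \<Longrightarrow> j \<in> I \<Longrightarrow> e i \<bullet> e j = (if i = j then 1 else 0)"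
  shows "(norm (x - (\<Sum>i\<in>I. c i *\<^sub>R e i)))\<^sup>2
       = (norm x)\<^sup>2 - (\<Sum>i\<in>I. (x \<bullet> e i)\<^sup>2) + (\<Sum>i\<in>I. (c i - x \<bullet> e i)\<^sup>2)"
proof -
  let ?y = "\<Sum>i\<in>I. c i *\<^sub>R e i"
  have ye: "?y \<bullet> e j = c j" if "j \<in> I" for j
  proof -
    have "?y \<bullet> e j = (\<Sum>i\<in>I. if i = j then c i else 0)"
      unfolding inner_sum_left by (rule sum.cong) (use that orth in auto)
    also have "\<dots> = c j" using fin that by simp
    finally show ?thesis .
  qed
  have yy: "?y \<bullet> ?y = (\<Sum>i\<in>I. (c i)\<^sup>2)"
    unfolding inner_sum_right[of ?y]
    by (rule sum.cong) (simp_all add: ye power2_eq_square)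
  have xy: "x \<bullet> ?y = (\<Sum>i\<in>I. c i * (x \<bullet> e i))"
    by (simp add: inner_sum_right)
  have "(norm (x - ?y))\<^sup>2 = x \<bullet> x - 2 * (x \<bullet> ?y) + ?y \<bullet> ?y"
    by (simp add: power2_norm_eq_inner inner_diff_left inner_diff_right inner_commute)
  moreover have "(\<Sum>i\<in>I. (c i - x \<bullet> e i)\<^sup>2)
      = (\<Sum>i\<in>I. (c i)\<^sup>2) - 2 * (\<Sum>i\<in>I. c i * (x \<bullet> e i)) + (\<Sum>i\<in>I. (x \<bullet> e i)\<^sup>2)"
    by (simp add: power2_diff sum.distrib sum_subtractf sum_distrib_left mult.assoc)
  ultimately show ?thesis
    by (simp only: yy xy power2_norm_eq_inner)
qed

lemma norm_orthonormal_combination: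
  fixes e :: "'i \<Rightarrow> 'a::real_inner"
  assumes "finite I"
    and "\<And>i j. i \<in> I \<Longrightarrow> j \<in> I \<Longrightarrow> e i \<bullet> e j = (if i = j then 1 else 0)"
  shows "(norm (\<Sum>i\<in>I. c i *\<^sub>R e i))\<^sup>2 = (\<Sum>i\<in>I. (c i)\<^sup>2)"
  using norm_diff_orthonormal_combination[OF assms, of 0 c] by simp

lemma bessel_inequality:
  fixes e :: "'i \<Rightarrow> 'a::real_inner"
  assumes "finite I"
    and "\<And>i j. i \<in> I \<Longrightarrow> j \<in> I \<Longrightarrow> e i \<bullet> e j = (if i = j then 1 else 0)"
  shows "(\<Sum>i\<in>I. (x \<bullet> e i)\<^sup>2) \<le> (norm x)\<^sup>2"
  using norm_diff_orthonormal_combination[OF assms, of x "\<lambda>i. x \<bullet> e i"]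
    zero_le_power2[of "norm (x - (\<Sum>i\<in>I. (x \<bullet> e i) *\<^sub>R e i))"] by simp

lemma orthonormal_upto_inner:
  assumes "orthonormal_upto p u" and "i \<in> {..<p}" and "j \<in> {..<p}"
  shows "u i \<bullet> u j = (if i = j then 1 else 0)"
  using assms by (simp add: orthonormal_upto_def)

section \<open>A rearrangement inequality\<close>

text \<open>
  A value \<open>c \<ge> 0\<close> separating \<open>f\<close> on \<open>S\<close> from \<open>f\<close> off \<open>S\<close> acts as a price: mass outside \<open>S\<close>
  earns at most \<open>c\<close> per unit, and the room it could fill inside \<open>S\<close> earns at least \<open>c\<close>.
\<close>

lemma sum_weighted_le_sum_largest:
  fixes f t :: "'i \<Rightarrow> real"
  assumes fin: "finite A" and SA: "S \<subseteq> A"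
    and largest: "\<And>i j. i \<in> S \<Longrightarrow> j \<in> A - S \<Longrightarrow> f j \<le> f i"
    and f0: "\<And>i. i \<in> A \<Longrightarrow> 0 \<le> f i"
    and t0: "\<And>i. i \<in> A \<Longrightarrow> 0 \<le> t i" and t1: "\<And>i. i \<in> A \<Longrightarrow> t i \<le> 1"
    and mass: "(\<Sum>i\<in>A. t i) \<le> real (card S)"
  shows "(\<Sum>i\<in>A. f i * t i) \<le> (\<Sum>i\<in>S. f i)"
proof -
  have split: "(\<Sum>i\<in>A. g i) = (\<Sum>i\<in>A - S. g i) + (\<Sum>i\<in>S. g i)" for g :: "'i \<Rightarrow> real"
    using sum.subset_diff[OF SA fin] .
  \<comment> \<open>The inserted 0 serves the case \<open>A = S\<close>, in which there is no value off \<open>S\<close>.\<close>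
  define c where "c = Max (insert 0 (f ` (A - S)))"
  have fin': "finite (insert 0 (f ` (A - S)))" using fin by simp
  have c0: "0 \<le> c" unfolding c_def using fin' by (intro Max_ge) auto
  have above: "f j \<le> c" if "j \<in> A - S" for j
    unfolding c_def using fin' that by (intro Max_ge) auto
  have below: "c \<le> f i" if "i \<in> S" for i
    unfolding c_def using fin' that largest f0 SA by (subst Max_le_iff) auto
  have "(\<Sum>i\<in>A - S. f i * t i) \<le> (\<Sum>i\<in>A - S. c * t i)"
    using above t0 by (intro sum_mono mult_right_mono) auto
  also have "\<dots> = c * (\<Sum>i\<in>A. t i) - c * (\<Sum>i\<in>S. t i)"
    by (simp add: split[of t] sum_distrib_left[symmetric] distrib_left)
  also have "\<dots> \<le> c * real (card S) - c * (\<Sum>i\<in>S. t i)"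
    using mult_left_mono[OF mass c0] by simp
  also have "\<dots> = (\<Sum>i\<in>S. c * (1 - t i))"
    by (simp add: sum_distrib_left right_diff_distrib sum_subtractf)
  also have "\<dots> \<le> (\<Sum>i\<in>S. f i * (1 - t i))"
    using below t1 SA by (intro sum_mono mult_right_mono) auto
  finally show ?thesis
    by (simp add: split[of "\<lambda>i. f i * t i"] right_diff_distrib sum_subtractf)
qed

section \<open>Rows, rank and row sparsity\<close>

lemma norm_matrix_sq_rows:
  fixes X :: "real ^ 'n ^ 'm"
  shows "(norm X)\<^sup>2 = (\<Sum>i\<in>UNIV. (norm (X $ i))\<^sup>2)"
  by (simp add: norm_vec_def L2_set_def sum_nonneg)

lemma norm_matrix_sq_mono:
  fixes X Y :: "real ^ 'n ^ 'm"
  assumes "\<And>i. norm (X $ i) \<le> norm (Y $ i)"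
  shows "(norm X)\<^sup>2 \<le> (norm Y)\<^sup>2"
  unfolding norm_matrix_sq_rows using assms by (intro sum_mono power_mono) auto

lemma norm_matrix_sq_add_rows_orthogonal:
  fixes X Y :: "real ^ 'n ^ 'm"
  assumes "\<And>i. X $ i \<bullet> Y $ i = 0"
  shows "(norm (X + Y))\<^sup>2 = (norm X)\<^sup>2 + (norm Y)\<^sup>2"
  using assms by (simp add: power2_norm_eq_inner inner_add_left inner_add_right
      inner_vec_def[of X Y] inner_commute[of Y X])

lemma restrict_rows_nth:
  "restrict_rows S X $ i = (if i \<in> S then X $ i else 0)"
  by (simp add: restrict_rows_def row_def vec_eq_iff)

lemma row_eq_nth: "row i X = X $ i"
  by (simp add: row_def vec_eq_iff)

lemma rank_eq_dim_range:
  fixes X :: "real ^ 'n ^ 'm"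
  shows "rank X = dim (range (($) X))"
  by (simp add: row_rank_def rows_def row_eq_nth full_SetCompr_eq)

lemma rank_le_if_rows_in_span:
  fixes X :: "real ^ 'n ^ 'm"
  assumes "\<And>i. X $ i \<in> span B"
  shows "rank X \<le> dim B"
proof -
  have "range (($) X) \<subseteq> span B" using assms by auto
  then have "dim (range (($) X)) \<le> dim (span B)" by (rule dim_subset)
  then show ?thesis by (simp add: rank_eq_dim_range)
qed

lemma rank_restrict_rows_le:
  fixes X :: "real ^ 'n ^ 'm"
  shows "rank (restrict_rows S X) \<le> rank X"
  unfolding rank_eq_dim_range[of X]
  by (rule rank_le_if_rows_in_span) (auto simp: restrict_rows_nth span_base span_zero)

lemma num_nonzero_rows_le:
  fixes X :: "real ^ 'n ^ 'm"
  assumes "\<And>i. i \<notin> S \<Longrightarrow> X $ i = 0"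
  shows "num_nonzero_rows X \<le> card S"
  unfolding num_nonzero_rows_def row_eq_nth using assms by (intro card_mono) auto

lemma norm_diff_restrict_rows_sq:
  fixes X :: "real ^ 'n ^ 'm"
  shows "(norm (X - restrict_rows S X))\<^sup>2
       = (norm X)\<^sup>2 - (\<Sum>i\<in>S. (norm (X $ i))\<^sup>2)"
proof -
  have "(norm (X - restrict_rows S X))\<^sup>2 = (\<Sum>i\<in>UNIV - S. (norm (X $ i))\<^sup>2)"
    unfolding norm_matrix_sq_rows
    by (rule sum.mono_neutral_cong_right) (auto simp: restrict_rows_nth)
  then show ?thesis
    using sum.subset_diff[of S UNIV "\<lambda>i. (norm (X $ i))\<^sup>2"] by (simp add: norm_matrix_sq_rows)
qed

text \<open>
  A competitor \<open>Y\<close> misses at least the mass of \<open>X\<close> outside the support of \<open>Y\<close>; the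
  indicator of that support is an admissible weight in the rearrangement inequality.
\<close>

lemma hard_thresholding_optimal:
  fixes X Y :: "real ^ 'n ^ 'm"
  assumes W: "W \<in> hard_thresholdings s X" and Y: "num_nonzero_rows Y \<le> s"
  shows "(norm (X - W))\<^sup>2 \<le> (norm (X - Y))\<^sup>2"
proof -
  obtain S where S: "W = restrict_rows S X" "card S = s"
      "\<forall>i\<in>S. \<forall>j\<in>-S. norm (row j X) \<le> norm (row i X)"
    using W unfolding hard_thresholdings_def by blast
  define R where "R = {i. Y $ i \<noteq> 0}"
  have cardR: "card R \<le> card S"
    using Y S by (simp add: R_def num_nonzero_rows_def row_eq_nth)
  let ?f = "\<lambda>i. (norm (X $ i))\<^sup>2" and ?t = "\<lambda>i. if i \<in> R then 1 else 0 :: real"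
  have "(\<Sum>i\<in>R. ?f i) = (\<Sum>i\<in>UNIV. ?f i * ?t i)"
    by (rule sum.mono_neutral_cong_left) auto
  also have "\<dots> \<le> (\<Sum>i\<in>S. ?f i)"
    by (rule sum_weighted_le_sum_largest)
      (use S cardR in \<open>auto simp: row_eq_nth power_mono sum.If_cases\<close>)
  finally have "(norm (X - W))\<^sup>2 \<le> (norm (X - restrict_rows R X))\<^sup>2"
    unfolding S(1) norm_diff_restrict_rows_sq by simp
  also have "\<dots> \<le> (norm (X - Y))\<^sup>2"
    by (rule norm_matrix_sq_mono) (auto simp: restrict_rows_nth R_def)
  finally show ?thesis .
qed

section \<open>Truncated singular value decompositions\<close>

lemma outer_prod_nth: "outer_prod a b $ i = a $ i *\<^sub>R b"
  by (simp add: outer_prod_def vec_eq_iff)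

lemma inner_outer_prod: "outer_prod a b \<bullet> outer_prod c d = (a \<bullet> c) * (b \<bullet> d)"
  by (simp add: inner_vec_def[of "outer_prod a b"] inner_vec_def[of a c] outer_prod_nth
      sum_distrib_right mult.left_commute mult.assoc)

lemma outer_prod_mult_vec: "outer_prod a b *v x = (b \<bullet> x) *\<^sub>R a"
  by (simp add: outer_prod_def vec_eq_iff matrix_vector_mult_def inner_vec_def
      sum_distrib_left sum_distrib_right ac_simps)

lemma norm_svd_mult_vec:
  fixes u :: "nat \<Rightarrow> real ^ 'm" and v :: "nat \<Rightarrow> real ^ 'n"
  assumes u: "orthonormal_upto p u"
  shows "(norm ((\<Sum>i<p. \<sigma> i *\<^sub>R outer_prod (u i) (v i)) *v x))\<^sup>2
       = (\<Sum>i<p. (\<sigma> i)\<^sup>2 * (v i \<bullet> x)\<^sup>2)"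
proof -
  have "(\<Sum>i<p. \<sigma> i *\<^sub>R outer_prod (u i) (v i)) *v x = (\<Sum>i<p. (\<sigma> i * (v i \<bullet> x)) *\<^sub>R u i)"
    by (induction p) (simp_all add: matrix_vector_mult_add_rdistrib outer_prod_mult_vec
        scaleR_matrix_vector_assoc[symmetric])
  then show ?thesis
    using norm_orthonormal_combination[of "{..<p}" u "\<lambda>i. \<sigma> i * (v i \<bullet> x)"]
      orthonormal_upto_inner[OF u] by (simp add: power_mult_distrib)
qed

text \<open>
  The rows of a competitor lie in a subspace of dimension at most \<open>k\<close>, so its error is at
  least the part of the rows of \<open>X\<close> orthogonal to that subspace; an orthonormal basis makes
  this part explicit.
\<close>

lemma norm_diff_low_rank_ge:
  fixes X Y :: "real ^ 'n ^ 'm"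
  obtains B where "finite B" "card B = rank Y"
    "\<And>b c. b \<in> B \<Longrightarrow> c \<in> B \<Longrightarrow> b \<bullet> c = (if b = c then 1 else 0)"
    "(norm X)\<^sup>2 - (\<Sum>b\<in>B. (norm (X *v b))\<^sup>2) \<le> (norm (X - Y))\<^sup>2"
proof -
  obtain B where B: "pairwise orthogonal B" "\<And>x. x \<in> B \<Longrightarrow> norm x = 1"
      "independent B" "card B = dim (span (range (($) Y)))" "span B = span (range (($) Y))"
    using orthonormal_basis_subspace[OF subspace_span[of "range (($) Y)"]] by metis
  have fin: "finite B" using B(3) by (rule independent_imp_finite)
  have orth: "b \<bullet> c = (if b = c then 1 else 0)" if "b \<in> B" "c \<in> B" for b c
    using B(1,2) that by (auto simp: pairwise_def orthogonal_def norm_eq_1)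
  have row: "(norm (X $ i))\<^sup>2 - (\<Sum>b\<in>B. (X $ i \<bullet> b)\<^sup>2) \<le> (norm (X $ i - Y $ i))\<^sup>2" for i
  proof -
    have "Y $ i \<in> span B" unfolding B(5) by (simp add: span_base)
    then obtain c where "Y $ i = (\<Sum>b\<in>B. c b *\<^sub>R b)"
      unfolding span_finite[OF fin] by auto
    then show ?thesis
      using norm_diff_orthonormal_combination[OF fin, of "\<lambda>b. b" "X $ i" c] orth
      by (simp add: sum_nonneg)
  qed
  have mv: "(norm (X *v b))\<^sup>2 = (\<Sum>i\<in>UNIV. (X $ i \<bullet> b)\<^sup>2)" for b
    by (simp add: norm_vec_def L2_set_def sum_nonneg matrix_vector_mul_component)
  have "(norm X)\<^sup>2 - (\<Sum>b\<in>B. (norm (X *v b))\<^sup>2)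
      = (\<Sum>i\<in>UNIV. (norm (X $ i))\<^sup>2 - (\<Sum>b\<in>B. (X $ i \<bullet> b)\<^sup>2))"
    unfolding mv norm_matrix_sq_rows sum_subtractf by (subst sum.swap) simp
  also have "\<dots> \<le> (norm (X - Y))\<^sup>2"
    unfolding norm_matrix_sq_rows using row by (intro sum_mono) simp
  finally show ?thesis
    using that[OF fin _ orth] B(4) by (simp add: rank_eq_dim_range)
qed

text \<open>
  The Eckart--Young theorem in the Frobenius norm. If \<open>B\<close> is an orthonormal basis of the row
  space of a competitor, the mass of \<open>X\<close> captured by \<open>B\<close> is \<open>\<Sum>i. (\<sigma> i)\<^sup>2 * t i\<close>, where
  \<open>t i\<close> is the squared length of the projection of the \<open>i\<close>-th right singular vector onto the
  row space. Bessel's inequality, applied once to \<open>B\<close> and once to the singular vectors,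
  gives \<open>t i \<le> 1\<close> and \<open>(\<Sum>i. t i) \<le> k\<close>, so no choice of \<open>B\<close> captures more than the \<open>k\<close>
  largest squared singular values.
\<close>

lemma svd_truncation_optimal:
  fixes X Y :: "real ^ 'n ^ 'm"
  assumes W: "W \<in> svd_truncations k X" and Y: "rank Y \<le> k"
  shows "(norm (X - W))\<^sup>2 \<le> (norm (X - Y))\<^sup>2"
proof -
  define p where "p = min CARD('m) CARD('n)"
  define q where "q = min k p"
  obtain \<sigma> u v where svd: "is_svd X \<sigma> u v"
      and W': "W = (\<Sum>i<q. \<sigma> i *\<^sub>R outer_prod (u i) (v i))"
    using W unfolding svd_truncations_def p_def q_def by auto
  have sv0: "\<And>i. i < p \<Longrightarrow> 0 \<le> \<sigma> i"
    and svdec: "\<And>i j. i \<le> j \<Longrightarrow> j < p \<Longrightarrow> \<sigma> j \<le> \<sigma> i"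
    and u: "orthonormal_upto p u" and v: "orthonormal_upto p v"
    and X: "X = (\<Sum>i<p. \<sigma> i *\<^sub>R outer_prod (u i) (v i))"
    using svd unfolding is_svd_def p_def Let_def by auto
  have orthE: "outer_prod (u i) (v i) \<bullet> outer_prod (u j) (v j) = (if i = j then 1 else 0)"
    if "i < p" "j < p" for i j
    using u v that by (auto simp: inner_outer_prod orthonormal_upto_def)
  have normX: "(norm X)\<^sup>2 = (\<Sum>i<p. (\<sigma> i)\<^sup>2)"
    unfolding X by (rule norm_orthonormal_combination) (use orthE in auto)
  have split: "{..<p} = {..<q} \<union> {q..<p}" by (auto simp: q_def)
  have "X - W = (\<Sum>i=q..<p. \<sigma> i *\<^sub>R outer_prod (u i) (v i))"
    unfolding X W' split by (subst sum.union_disjoint) auto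
  then have "(norm (X - W))\<^sup>2 = (\<Sum>i=q..<p. (\<sigma> i)\<^sup>2)"
    using norm_orthonormal_combination[of "{q..<p}" "\<lambda>i. outer_prod (u i) (v i)" \<sigma>] orthE
    by simp
  moreover have "(norm X)\<^sup>2 = (\<Sum>i<q. (\<sigma> i)\<^sup>2) + (\<Sum>i=q..<p. (\<sigma> i)\<^sup>2)"
    unfolding normX split by (rule sum.union_disjoint) auto
  ultimately have err: "(norm (X - W))\<^sup>2 = (norm X)\<^sup>2 - (\<Sum>i<q. (\<sigma> i)\<^sup>2)" by simp
  obtain B where fin: "finite B" and cardB: "card B = rank Y"
    and orthB: "\<And>b c. b \<in> B \<Longrightarrow> c \<in> B \<Longrightarrow> b \<bullet> c = (if b = c then 1 else 0)"
    and low: "(norm X)\<^sup>2 - (\<Sum>b\<in>B. (norm (X *v b))\<^sup>2) \<le> (norm (X - Y))\<^sup>2"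
    using norm_diff_low_rank_ge[of Y X] by metis
  define t where "t i = (\<Sum>b\<in>B. (v i \<bullet> b)\<^sup>2)" for i
  have "(\<Sum>b\<in>B. (norm (X *v b))\<^sup>2) = (\<Sum>b\<in>B. \<Sum>i<p. (\<sigma> i)\<^sup>2 * (v i \<bullet> b)\<^sup>2)"
    unfolding X norm_svd_mult_vec[OF u] ..
  also have "\<dots> = (\<Sum>i<p. (\<sigma> i)\<^sup>2 * t i)"
    unfolding t_def sum_distrib_left by (rule sum.swap)
  also have "\<dots> \<le> (\<Sum>i<q. (\<sigma> i)\<^sup>2)"
  proof (rule sum_weighted_le_sum_largest)
    show t1: "t i \<le> 1" if "i \<in> {..<p}" for i
      using bessel_inequality[OF fin, of "\<lambda>b. b" "v i"] orthB that
        orthonormal_upto_inner[OF v that that] by (simp add: t_def power2_norm_eq_inner)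
    have "(\<Sum>i<p. t i) = (\<Sum>b\<in>B. \<Sum>i<p. (b \<bullet> v i)\<^sup>2)"
      unfolding t_def by (subst sum.swap) (simp add: inner_commute)
    also have "\<dots> \<le> (\<Sum>b\<in>B. 1)"
    proof (rule sum_mono)
      fix b assume "b \<in> B"
      then show "(\<Sum>i<p. (b \<bullet> v i)\<^sup>2) \<le> 1"
        using bessel_inequality[of "{..<p}" v b] orthonormal_upto_inner[OF v] orthB[of b b]
        by (simp add: power2_norm_eq_inner)
    qed
    finally have "(\<Sum>i<p. t i) \<le> real k" using cardB Y by simp
    moreover have "(\<Sum>i<p. t i) \<le> real p"
      using sum_mono[of "{..<p}" t "\<lambda>_. 1"] t1 by simp
    ultimately show "(\<Sum>i<p. t i) \<le> real (card {..<q})" by (simp add: q_def)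
  qed (use sv0 svdec in \<open>auto simp: q_def t_def sum_nonneg intro!: power_mono\<close>)
  finally show ?thesis using err low by simp
qed

text \<open>
  Since \<open>X $ r = (\<Sum>i. (\<sigma> i * u i $ r) *\<^sub>R v i)\<close>, dropping the terms with \<open>i \<ge> k\<close> projects
  each row orthogonally onto the span of the first \<open>k\<close> right singular vectors.
\<close>

lemma svd_truncation_row_projection:
  fixes X :: "real ^ 'n ^ 'm"
  assumes W: "W \<in> svd_truncations k X"
  obtains \<pi> :: "real ^ 'n \<Rightarrow> real ^ 'n"
  where "linear \<pi>" "\<And>x y. (x - \<pi> x) \<bullet> \<pi> y = 0" "\<And>x. norm (\<pi> x) \<le> norm x"
    "\<And>r. W $ r = \<pi> (X $ r)" "rank W \<le> k"
proof -
  define p where "p = min CARD('m) CARD('n)"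
  define q where "q = min k p"
  obtain \<sigma> u v where svd: "is_svd X \<sigma> u v"
      and W': "W = (\<Sum>i<q. \<sigma> i *\<^sub>R outer_prod (u i) (v i))"
    using W unfolding svd_truncations_def p_def q_def by auto
  have v: "orthonormal_upto p v" and X: "X = (\<Sum>i<p. \<sigma> i *\<^sub>R outer_prod (u i) (v i))"
    using svd unfolding is_svd_def p_def Let_def by auto
  have vq: "v i \<bullet> v j = (if i = j then 1 else 0)" if "i \<in> {..<q}" "j \<in> {..<q}" for i j
    using orthonormal_upto_inner[OF v] that by (simp add: q_def)
  define \<pi> where "\<pi> x = (\<Sum>i<q. (x \<bullet> v i) *\<^sub>R v i)" for x
  have lin: "linear \<pi>"
    unfolding \<pi>_def by (rule linearI) (simp_all add: inner_add_left scaleR_add_left sum.distrib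
        scaleR_sum_right)
  have coeff: "\<pi> x \<bullet> v j = x \<bullet> v j" if "j < q" for x j
  proof -
    have "\<pi> x \<bullet> v j = (\<Sum>i<q. if i = j then x \<bullet> v j else 0)"
      unfolding \<pi>_def inner_sum_left by (rule sum.cong) (use that vq in auto)
    then show ?thesis using that by simp
  qed
  have orth: "(x - \<pi> x) \<bullet> \<pi> y = 0" for x y
  proof -
    have "(x - \<pi> x) \<bullet> \<pi> y = (\<Sum>i<q. (y \<bullet> v i) * ((x - \<pi> x) \<bullet> v i))"
      unfolding \<pi>_def[of y] by (simp add: inner_sum_right)
    then show ?thesis by (simp add: inner_diff_left coeff)
  qed
  have contr: "norm (\<pi> x) \<le> norm x" for x
  proof (rule power2_le_imp_le)
    show "(norm (\<pi> x))\<^sup>2 \<le> (norm x)\<^sup>2"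
      unfolding \<pi>_def using bessel_inequality[of "{..<q}" v x] vq
      by (subst norm_orthonormal_combination) auto
  qed simp
  have rows: "W $ r = \<pi> (X $ r)" for r
  proof -
    have c: "X $ r \<bullet> v j = \<sigma> j * u j $ r" if "j < q" for j
    proof -
      have "X $ r \<bullet> v j = (\<Sum>i<p. if i = j then \<sigma> j * u j $ r else 0)"
        unfolding X sum_component inner_sum_left
        by (rule sum.cong) (use that orthonormal_upto_inner[OF v] in
            \<open>auto simp: outer_prod_nth q_def\<close>)
      then show ?thesis using that by (simp add: q_def)
    qed
    show ?thesis by (simp add: W' \<pi>_def c sum_component outer_prod_nth)
  qed
  have "\<pi> x \<in> span (v ` {..<q})" for x
    unfolding \<pi>_def by (intro span_sum span_scale span_base) simp
  then have "rank W \<le> dim (v ` {..<q})"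
    by (intro rank_le_if_rows_in_span) (simp add: rows)
  also have "\<dots> \<le> card (v ` {..<q})" by (rule dim_le_card') simp
  also have "\<dots> \<le> k" using card_image_le[of "{..<q}" v] by (simp add: q_def)
  finally show ?thesis using that[OF lin orth contr rows] by blast
qed

section \<open>Quasi-optimality of the composed projections\<close>

lemma norm_le_sqrt2_mult:
  assumes "(norm z)\<^sup>2 = a + b" and "a \<le> d\<^sup>2" and "b \<le> d\<^sup>2" and "0 \<le> d"
  shows "norm z \<le> sqrt 2 * d"
  by (rule power2_le_imp_le) (use assms in \<open>simp_all add: power_mult_distrib\<close>)

lemma truncated_thresholding_quasi_optimal:
  fixes X Y :: "real ^ 'n ^ 'm"
  assumes W: "W \<in> hard_thresholdings s X" and Z: "Z \<in> svd_truncations k W"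
    and Y: "Y \<in> low_rank_row_sparse k s"
  shows "Z \<in> low_rank_row_sparse k s" and "norm (X - Z) \<le> sqrt 2 * norm (X - Y)"
proof -
  have Yr: "rank Y \<le> k" and Ys: "num_nonzero_rows Y \<le> s"
    using Y by (auto simp: low_rank_row_sparse_def)
  obtain S where S: "W = restrict_rows S X" "card S = s"
    using W unfolding hard_thresholdings_def by blast
  obtain \<pi> where \<pi>: "linear \<pi>" "\<And>r. Z $ r = \<pi> (W $ r)" "rank Z \<le> k"
    using svd_truncation_row_projection[OF Z] by metis
  have Z0: "Z $ r = 0" if "r \<notin> S" for r
    using that by (simp add: \<pi>(2) S(1) restrict_rows_nth linear_0[OF \<pi>(1)])
  show "Z \<in> low_rank_row_sparse k s"
    using \<pi>(3) num_nonzero_rows_le[of S Z, OF Z0] S(2) by (simp add: low_rank_row_sparse_def)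
  have "(norm ((X - W) + (W - Z)))\<^sup>2 = (norm (X - W))\<^sup>2 + (norm (W - Z))\<^sup>2"
    by (rule norm_matrix_sq_add_rows_orthogonal) (simp add: S(1) restrict_rows_nth Z0)
  then have split: "(norm (X - Z))\<^sup>2 = (norm (X - W))\<^sup>2 + (norm (W - Z))\<^sup>2" by simp
  have "(norm (W - Z))\<^sup>2 \<le> (norm (W - restrict_rows S Y))\<^sup>2"
    using svd_truncation_optimal[OF Z] rank_restrict_rows_le[of S Y] Yr by simp
  also have "\<dots> \<le> (norm (X - Y))\<^sup>2"
    by (rule norm_matrix_sq_mono) (simp add: S(1) restrict_rows_nth)
  finally show "norm (X - Z) \<le> sqrt 2 * norm (X - Y)"
    using norm_le_sqrt2_mult[OF split hard_thresholding_optimal[OF W Ys]] by simp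
qed

lemma thresholded_truncation_quasi_optimal:
  fixes X Y :: "real ^ 'n ^ 'm"
  assumes W: "W \<in> svd_truncations k X" and Z: "Z \<in> hard_thresholdings s W"
    and Y: "Y \<in> low_rank_row_sparse k s"
  shows "Z \<in> low_rank_row_sparse k s" and "norm (X - Z) \<le> sqrt 2 * norm (X - Y)"
proof -
  have Yr: "rank Y \<le> k" and Ys: "num_nonzero_rows Y \<le> s"
    using Y by (auto simp: low_rank_row_sparse_def)
  obtain S where S: "Z = restrict_rows S W" "card S = s"
    using Z unfolding hard_thresholdings_def by blast
  obtain \<pi> where \<pi>: "linear \<pi>" "\<And>x y. (x - \<pi> x) \<bullet> \<pi> y = 0" "\<And>x. norm (\<pi> x) \<le> norm x"
      "\<And>r. W $ r = \<pi> (X $ r)" "rank W \<le> k"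
    using svd_truncation_row_projection[OF W] by metis
  show "Z \<in> low_rank_row_sparse k s"
    using rank_restrict_rows_le[of S W] \<pi>(5) num_nonzero_rows_le[of S Z] S
    by (simp add: low_rank_row_sparse_def restrict_rows_nth)
  have "(norm ((X - W) + (W - Z)))\<^sup>2 = (norm (X - W))\<^sup>2 + (norm (W - Z))\<^sup>2"
    by (rule norm_matrix_sq_add_rows_orthogonal) (simp add: S(1) restrict_rows_nth \<pi>(2,4))
  then have split: "(norm (X - Z))\<^sup>2 = (norm (X - W))\<^sup>2 + (norm (W - Z))\<^sup>2" by simp
  define Y' where "Y' = (\<chi> r. \<pi> (Y $ r))"
  have "num_nonzero_rows Y' \<le> num_nonzero_rows Y"
    unfolding num_nonzero_rows_def[of Y]
    by (rule num_nonzero_rows_le) (simp add: Y'_def row_eq_nth linear_0[OF \<pi>(1)])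
  then have "(norm (W - Z))\<^sup>2 \<le> (norm (W - Y'))\<^sup>2"
    using hard_thresholding_optimal[OF Z] Ys by simp
  also have "\<dots> \<le> (norm (X - Y))\<^sup>2"
    by (rule norm_matrix_sq_mono) (simp add: Y'_def \<pi>(3,4) linear_diff[OF \<pi>(1), symmetric])
  finally show "norm (X - Z) \<le> sqrt 2 * norm (X - Y)"
    using norm_le_sqrt2_mult[OF split svd_truncation_optimal[OF W Yr]] by simp
qed

theorem proposition2p2:
  fixes k s :: nat
    and T H P :: "real ^ 'n ^ 'm \<Rightarrow> real ^ 'n ^ 'm"
    and X :: "real ^ 'n ^ 'm"
  assumes "0 < k" and "k < s" and "s \<le> CARD('m)"
    and T: "\<And>Z. T Z \<in> svd_truncations k Z"
    and H: "\<And>Z. H Z \<in> hard_thresholdings s Z"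
    and P: "\<And>Z. P Z \<in> metric_projections (low_rank_row_sparse k s) Z"
  shows "(T \<circ> H) X \<in> low_rank_row_sparse k s
       \<and> (H \<circ> T) X \<in> low_rank_row_sparse k s
       \<and> norm (X - (T \<circ> H) X) \<le> sqrt 2 * norm (X - P X)
       \<and> norm (X - (H \<circ> T) X) \<le> sqrt 2 * norm (X - P X)"
proof -
  have "P X \<in> low_rank_row_sparse k s"
    using P[of X] by (simp add: metric_projections_def)
  then show ?thesis
    using truncated_thresholding_quasi_optimal[OF H T] thresholded_truncation_quasi_optimal[OF T H]
    by simp
qed

end
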